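(* For all integers $m,n\ge 3$ there exists an optimal decomposable entanglement witness $W$ acting on $\mathbb{C}^m\otimes\mathbb{C}^n$ such that the set of product vectors $$\mathcal{P}_W=\{\,|e,f\rangle=|e\rangle\otimes|f\rangle\in\mathbb{C}^m\otimes\mathbb{C}^n \;:\; \langle e,f|W|e,f\rangle=0\,\}$$ does not span $\mathbb{C}^m\otimes\mathbb{C}^n$.
   Context: Let $\mathbb{M}_{m,n}=M_m(\mathbb{C})\otimes M_n(\mathbb{C})$ be the set of operators on $\mathbb{C}^m\otimes\mathbb{C}^n$. A state (density matrix) is a positive semidefinite element of $\mathbb{M}_{m,n}$ with unit trace. "Positive" ($\ge 0$) for operators means positive semidefinite. An entanglement witness (EW) is a Hermitian operator $W\in\mathbb{M}_{m,n}$ which is block-positive, i.e. $\langle e,f|W|e,f\rangle\ge 0$ for every product vector $|e\rangle\otimes|f\rangle\in\mathbb{C}^m\otimes\mathbb{C}^n$, and for which there is a state $\rho$ (necessarily entangled) with $\mathrm{Tr}(W\rho)<0$. $\Gamma$ denotes the partial transposition with respect to the second subsystem in the standard basis: $(A\otimes B)^\Gamma=A\otimes B^T$, extended linearly. An EW $W$ is decomposable if $W=P+Q^\Gamma$ for some positive operators $P,Q\in\mathbb{M}_{m,n}$. For an EW $W$ let $\mathcal{D}_W$ be the set of states $\varrho$ with $\mathrm{Tr}(\varrho W)<0$. An EW $W_1$ is finer than an EW $W_2$ if $\mathcal{D}_{W_2}\subseteq\mathcal{D}_{W_1}$. An EW $W$ is optimal if its detected set is maximal with respect to this inclusion, i.e.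 there is no EW $W'$ with $\mathcal{D}_W\subsetneq\mathcal{D}_{W'}$ (equivalently, $W-\epsilon P$ is not block-positive for any $\epsilon>0$ and any nonzero $P\ge 0$). *)

theory Defs
  imports "HOL-Analysis.Analysis" "HOL-Library.Complex_Order"
begin

text \<open>
  Operators on the tensor product of the spaces \<open>complex^'m\<close> and \<open>complex^'n\<close> are matrices in the
  standard product basis, which is indexed by \<open>'m \<times> 'n\<close>. The order on \<^typ>\<open>complex\<close> is the
  one of \<^theory>\<open>HOL-Library.Complex_Order\<close>: \<open>0 \<le> z\<close> says that \<open>z\<close> is real and
  nonnegative, \<open>z < 0\<close> that \<open>z\<close> is real and negative.
\<close>

type_synonym ('m, 'n) bipartite_op = "complex^('m \<times> 'n)^('m \<times> 'n)"

definition braket :: "complex^'i \<Rightarrow> complex^'i \<Rightarrow> complex" where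
  "braket x y = (\<Sum>i\<in>UNIV. cnj (x $ i) * y $ i)"

definition hermitian :: "complex^'i^'i \<Rightarrow> bool" where
  "hermitian A \<longleftrightarrow> (\<forall>i j. A $ i $ j = cnj (A $ j $ i))"

definition psd :: "complex^'i^'i \<Rightarrow> bool" where
  "psd A \<longleftrightarrow> hermitian A \<and> (\<forall>x. 0 \<le> braket x (A *v x))"

definition state :: "complex^'i^'i \<Rightarrow> bool" where
  "state \<rho> \<longleftrightarrow> psd \<rho> \<and> trace \<rho> = 1"

definition tensor_vec :: "complex^('m::finite) \<Rightarrow> complex^('n::finite) \<Rightarrow> complex^('m \<times> 'n)" where
  "tensor_vec e f = (\<chi> p. e $ fst p * f $ snd p)"

definition tensor_op :: "complex^('m::finite)^'m \<Rightarrow> complex^('n::finite)^'n \<Rightarrow> ('m, 'n) bipartite_op" where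
  "tensor_op A B = (\<chi> p q. A $ fst p $ fst q * B $ snd p $ snd q)"

definition partial_transpose :: "('m::finite, 'n::finite) bipartite_op \<Rightarrow> ('m, 'n) bipartite_op" where
  "partial_transpose X = (\<chi> p q. X $ (fst p, snd q) $ (fst q, snd p))"

text \<open>
  The three lemmas below determine \<^const>\<open>partial_transpose\<close>, because the operators
  \<^term>\<open>tensor_op A B\<close> span all bipartite operators.
\<close>

lemma partial_transpose_tensor_op:
  "partial_transpose (tensor_op A B) = tensor_op A (transpose B)"
  by (simp add: partial_transpose_def tensor_op_def transpose_def vec_eq_iff)

lemma partial_transpose_add:
  "partial_transpose (X + Y) = partial_transpose X + partial_transpose Y"
  by (simp add: partial_transpose_def vec_eq_iff)

lemma partial_transpose_scale:
  "partial_transpose (\<chi> p q. c * X $ p $ q) = (\<chi> p q. c * partial_transpose X $ p $ q)"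
  by (simp add: partial_transpose_def vec_eq_iff)

definition block_positive :: "('m::finite, 'n::finite) bipartite_op \<Rightarrow> bool" where
  "block_positive W \<longleftrightarrow>
     (\<forall>e f. 0 \<le> braket (tensor_vec e f) (W *v tensor_vec e f))"

definition detected :: "complex^'i^'i \<Rightarrow> (complex^'i^'i) set" where
  "detected W = {\<rho>. state \<rho> \<and> trace (\<rho> ** W) < 0}"

definition entanglement_witness :: "('m::finite, 'n::finite) bipartite_op \<Rightarrow> bool" where
  "entanglement_witness W \<longleftrightarrow>
     hermitian W \<and> block_positive W \<and> (\<exists>\<rho>. state \<rho> \<and> trace (W ** \<rho>) < 0)"

definition decomposable_witness :: "('m::finite, 'n::finite) bipartite_op \<Rightarrow> bool" where
  "decomposable_witness W \<longleftrightarrow>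
     entanglement_witness W \<and> (\<exists>P Q. psd P \<and> psd Q \<and> W = P + partial_transpose Q)"

definition finer :: "('m::finite, 'n::finite) bipartite_op \<Rightarrow> ('m, 'n) bipartite_op \<Rightarrow> bool" where
  "finer W\<^sub>1 W\<^sub>2 \<longleftrightarrow> detected W\<^sub>2 \<subseteq> detected W\<^sub>1"

definition optimal_witness :: "('m::finite, 'n::finite) bipartite_op \<Rightarrow> bool" where
  "optimal_witness W \<longleftrightarrow>
     entanglement_witness W \<and>
     \<not> (\<exists>W'. entanglement_witness W' \<and> finer W' W \<and> detected W' \<noteq> detected W)"

definition zero_product_vectors :: "('m::finite, 'n::finite) bipartite_op \<Rightarrow> (complex^('m \<times> 'n)) set" where
  "zero_product_vectors W =
     {tensor_vec e f | e f. braket (tensor_vec e f) (W *v tensor_vec e f) = 0}"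

end

theory Submission
  imports Defs
begin

text \<open>
  Write \<open>(x, y, z)\<close> for three coordinates of \<open>e\<close> and \<open>(a, b, c)\<close> for the conjugates of three
  coordinates of \<open>f\<close>. The witness is a partial transpose \<open>W = Q\<^sup>\<Gamma>\<close> with
  \<open>\<langle>e,f|W|e,f\<rangle> = |xb - ya + za|\<^sup>2 + |xc - za|\<^sup>2 + |yc - zb|\<^sup>2\<close>.
  The ideal of the three forms contains \<open>xc\<^sup>2\<close>, so \<open>xc\<close> vanishes at every zero and the zeros do not
  span. The zero scheme is however not reduced: along \<open>e = (1, \<tau>, \<tau>)\<close>, \<open>(a, b, c) = (1, 0, \<tau>)\<close> the
  expectation is only \<open>|\<tau>|\<^sup>4\<close>, so a positive \<open>P\<close> for which \<open>\<mu>W - P\<close> is block-positive must also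
  kill the first-order coefficients of this curve, and together with the zeros they span.
\<close>

section \<open>Inner products, expectations and positive semidefinite matrices\<close>

definition expect :: "complex^'i^'i \<Rightarrow> complex^'i \<Rightarrow> complex" where
  "expect A x = braket x (A *v x)"

definition rank_one :: "complex^'i \<Rightarrow> complex^'i^'i" where
  "rank_one x = (\<chi> i j. x $ i * cnj (x $ j))"

lemma braket_add_left: "braket (x + y) z = braket x z + braket y z"
  by (simp add: braket_def sum.distrib algebra_simps)

lemma braket_diff_left: "braket (x - y) z = braket x z - braket y z"
  by (simp add: braket_def sum_subtractf algebra_simps)

lemma braket_add_right: "braket z (x + y) = braket z x + braket z y"
  by (simp add: braket_def sum.distrib algebra_simps)

lemma braket_scale_left: "braket (c *s x) z = cnj c * braket x z"
  by (simp add: braket_def sum_distrib_left algebra_simps)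

lemma braket_scale_right: "braket z (c *s x) = c * braket z x"
  by (simp add: braket_def sum_distrib_left algebra_simps)

lemma braket_axis: "braket (axis p 1) x = x $ p"
proof -
  have "braket (axis p 1) x = (\<Sum>i\<in>UNIV. if i = p then x $ i else 0)"
    unfolding braket_def by (intro sum.cong refl) (simp add: axis_def)
  then show ?thesis by simp
qed

lemma braket_self: "braket x x = of_real (\<Sum>i\<in>UNIV. (cmod (x $ i))\<^sup>2)"
proof -
  have "braket x x = (\<Sum>i\<in>UNIV. of_real ((cmod (x $ i))\<^sup>2))"
    unfolding braket_def
    by (intro sum.cong refl) (simp only: complex_norm_square mult.commute)
  then show ?thesis by simp
qed

lemma matrix_vector_mult_axis: "(A *v axis k 1) $ i = A $ i $ k" for A :: "complex^'i^'j"
  by (simp add: matrix_vector_mult_def axis_def if_distrib[of "\<lambda>z. c * z" for c] cong: if_cong)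

lemma Re_braket_self_nonneg: "0 \<le> Re (braket x x)"
  by (simp add: braket_self sum_nonneg)

lemma braket_self_eq_0: "Re (braket x x) = 0 \<Longrightarrow> x = 0"
  by (simp add: braket_self sum_nonneg_eq_0_iff vec_eq_iff)

lemma hermitian_iff_cnj: "hermitian A \<longleftrightarrow> (\<forall>i j. cnj (A $ i $ j) = A $ j $ i)"
  unfolding hermitian_def by (metis complex_cnj_cnj)

lemma hermitian_braket:
  assumes "hermitian A"
  shows "braket x (A *v y) = cnj (braket y (A *v x))"
proof -
  have "cnj (braket y (A *v x)) = (\<Sum>i\<in>UNIV. \<Sum>j\<in>UNIV. y $ i * (cnj (A $ i $ j) * cnj (x $ j)))"
    by (simp add: braket_def matrix_vector_mult_def sum_distrib_left)
  also have "\<dots> = (\<Sum>j\<in>UNIV. \<Sum>i\<in>UNIV. y $ i * (cnj (A $ i $ j) * cnj (x $ j)))"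
    by (rule sum.swap)
  also have "\<dots> = (\<Sum>j\<in>UNIV. \<Sum>i\<in>UNIV. cnj (x $ j) * (A $ j $ i * y $ i))"
    by (simp add: assms[unfolded hermitian_iff_cnj] mult_ac)
  also have "\<dots> = braket x (A *v y)"
    by (simp add: braket_def matrix_vector_mult_def sum_distrib_left)
  finally show ?thesis ..
qed

lemma hermitian_expect_real: "hermitian A \<Longrightarrow> Im (expect A x) = 0"
  unfolding expect_def using hermitian_braket[of A x x]
  by (metis add.inverse_neutral cnj.simps(2) equal_neg_zero)

lemma expect_scale: "expect A (c *s x) = of_real ((cmod c)\<^sup>2) * expect A x"
  by (simp add: expect_def braket_scale_left braket_scale_right vector_scalar_commute
      complex_norm_square del: of_real_power)

lemma expect_diff: "expect (A - B) x = expect A x - expect B x"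
  by (simp add: expect_def braket_def matrix_vector_mult_diff_rdistrib sum_subtractf algebra_simps)

lemma expect_add: "expect (A + B) x = expect A x + expect B x"
  by (simp add: expect_def braket_add_right matrix_vector_mult_add_rdistrib)

lemma scaleR_entry: "(r *\<^sub>R A) $ i $ j = complex_of_real r * A $ i $ j"
  by (simp only: vector_scaleR_component) (rule scaleR_conv_of_real)

lemma scaleR_matrix_vector: "((r *\<^sub>R A) *v x) = complex_of_real r *s (A *v x)"
  for A :: "complex^'i^'j"
  by (simp add: vec_eq_iff matrix_vector_mult_def sum_distrib_left scaleR_entry mult.assoc
      del: vector_scaleR_component)

lemma expect_scaleR: "expect (r *\<^sub>R A) x = of_real r * expect A x"
  by (simp add: expect_def scaleR_matrix_vector braket_scale_right)

text \<open>Hermitian expectations are real, so the complex order reduces to a real inequality; the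
  later estimates are stated for real parts.\<close>

lemma psd_iff_expect:
  "psd A \<longleftrightarrow> hermitian A \<and> (\<forall>x. 0 \<le> Re (expect A x))"
  unfolding psd_def less_eq_complex_def expect_def[symmetric]
  by (auto dest: hermitian_expect_real)

lemma hermitian_add: "hermitian A \<Longrightarrow> hermitian B \<Longrightarrow> hermitian (A + B)"
  by (simp add: hermitian_iff_cnj)

lemma hermitian_diff: "hermitian A \<Longrightarrow> hermitian B \<Longrightarrow> hermitian (A - B)"
  by (simp add: hermitian_iff_cnj)

lemma hermitian_scaleR: "hermitian A \<Longrightarrow> hermitian (r *\<^sub>R A)"
  by (simp add: hermitian_iff_cnj scaleR_entry del: vector_scaleR_component)

lemma hermitian_rank_one: "hermitian (rank_one x)"
  by (simp add: hermitian_iff_cnj rank_one_def)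

lemma hermitian_partial_transpose: "hermitian X \<Longrightarrow> hermitian (partial_transpose X)"
  by (simp add: hermitian_iff_cnj partial_transpose_def)

lemma expect_rank_one: "expect (rank_one x) y = of_real ((cmod (braket x y))\<^sup>2)"
proof -
  have "rank_one x *v y = braket x y *s x"
    by (simp add: vec_eq_iff rank_one_def matrix_vector_mult_def braket_def
        sum_distrib_left mult_ac)
  moreover have "braket y x = cnj (braket x y)"
    by (simp add: braket_def mult.commute)
  ultimately show ?thesis
    by (simp add: expect_def braket_scale_right complex_norm_square del: of_real_power)
qed

lemma psd_add: "psd A \<Longrightarrow> psd B \<Longrightarrow> psd (A + B)"
  by (simp add: psd_iff_expect hermitian_add expect_add)

lemma psd_scaleR: "psd A \<Longrightarrow> 0 \<le> r \<Longrightarrow> psd (r *\<^sub>R A)"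
  by (simp add: psd_iff_expect hermitian_scaleR expect_scaleR)

lemma psd_rank_one: "psd (rank_one x)"
  by (simp add: psd_iff_expect hermitian_rank_one expect_rank_one del: of_real_power)

lemma psd_zero: "psd 0"
  by (simp add: psd_iff_expect hermitian_def expect_def braket_def)

lemma trace_scaleR: "trace (r *\<^sub>R A) = of_real r * trace A" for A :: "complex^'i^'i"
  by (simp add: trace_def sum_distrib_left scaleR_entry del: vector_scaleR_component)

text \<open>Turns detection, which is defined by traces, into expectations at vectors.\<close>

lemma trace_mult_rank_one: "trace (rank_one x ** A) = expect A x"
proof -
  have "trace (rank_one x ** A) = (\<Sum>i\<in>UNIV. \<Sum>j\<in>UNIV. x $ i * cnj (x $ j) * A $ j $ i)"
    by (simp add: trace_def matrix_matrix_mult_def rank_one_def)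
  also have "\<dots> = (\<Sum>j\<in>UNIV. \<Sum>i\<in>UNIV. x $ i * cnj (x $ j) * A $ j $ i)"
    by (rule sum.swap)
  also have "\<dots> = expect A x"
    by (simp add: expect_def braket_def matrix_vector_mult_def sum_distrib_left mult_ac)
  finally show ?thesis .
qed

lemma trace_rank_one: "trace (rank_one x) = braket x x"
  by (simp add: trace_def rank_one_def braket_def mult.commute)

lemma scaleR_matrix_mult: "(r *\<^sub>R A) ** B = r *\<^sub>R (A ** B)" for A B :: "complex^'i^'i"
  by (simp add: vec_eq_iff matrix_matrix_mult_def scaleR_sum_right)

lemma matrix_add_rdistrib: "(A + B) ** C = A ** C + B ** C" for A B C :: "complex^'i^'i"
  by (simp add: vec_eq_iff matrix_matrix_mult_def sum.distrib algebra_simps)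

lemma matrix_mult_scaleR: "A ** (r *\<^sub>R B) = r *\<^sub>R (A ** B)" for A B :: "complex^'i^'i"
  by (simp add: vec_eq_iff matrix_matrix_mult_def scaleR_sum_right)

section \<open>Kernels of positive semidefinite matrices\<close>

lemma psd_kernel:
  assumes "psd P" and "expect P x = 0"
  shows "P *v x = 0"
proof -
  have h: "hermitian P" using assms(1) by (simp add: psd_def)
  define y where "y = P *v x"
  define N where "N = Re (braket y y)"
  define K where "K = Re (expect P y)"
  have yx: "braket y (P *v x) = of_real N"
    unfolding N_def y_def by (simp add: complex_eq_iff braket_self del: of_real_power)
  have xy: "braket x (P *v y) = of_real N"
    using hermitian_braket[OF h, of x y] yx by simp
  \<comment> \<open>Positivity is tested at \<open>x - s y\<close> with \<open>y = P *v x\<close>.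
    Since \<open>expect P x\<close> is zero, only the linear term \<open>- 2 s N\<close> and the
    quadratic term \<open>s^2 K\<close> remain.\<close>
  have ineq: "2 * s * N \<le> s\<^sup>2 * K" for s :: real
  proof -
    have "expect P (x + c *s y) = expect P x + c * braket x (P *v y) + cnj c * braket y (P *v x)
        + cnj c * c * expect P y" for c
      by (simp add: expect_def matrix_vector_right_distrib braket_add_left braket_add_right
          vector_scalar_commute braket_scale_left braket_scale_right algebra_simps)
    from this[of "- of_real s"]
    have "Re (expect P (x + (- of_real s) *s y)) = s\<^sup>2 * K - 2 * s * N"
      using assms(2) xy yx by (simp add: K_def power2_eq_square del: vector_smult_lneg)
    then show ?thesis
      using assms(1) unfolding psd_iff_expect by (metis diff_ge_0_iff_ge)
  qed
  have "N \<le> 0"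
  proof (rule ccontr)
    assume "\<not> N \<le> 0"
    then have N: "N > 0" by simp
    \<comment> \<open>Small enough that \<open>s K\<close> is at most \<open>N\<close>, which
      contradicts \<open>2 N \<le> s K\<close>. The summand 1 keeps the denominator
      positive.\<close>
    define s where "s = N / (\<bar>K\<bar> + 1)"
    have s: "s > 0" using N by (simp add: s_def)
    have "2 * s * N \<le> s * (s * K)" using ineq[of s] by (simp add: power2_eq_square mult.assoc)
    then have "2 * N \<le> s * K" using s by simp
    also have "s * K \<le> s * (\<bar>K\<bar> + 1)" using s by (intro mult_left_mono) auto
    also have "\<dots> = N" by (simp add: s_def)
    finally show False using N by simp
  qed
  then have "N = 0" using Re_braket_self_nonneg[of y] by (simp add: N_def)
  then show ?thesis using braket_self_eq_0[of y] by (simp add: N_def y_def)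
qed

text \<open>Hermiticity lets \<open>P\<close> act on either argument. A curve of vectors can thus be
  replaced by its part modulo the kernel of \<open>P\<close> without changing the
  expectation.\<close>

lemma expect_cong_image:
  assumes "hermitian P" and "P *v x = P *v y"
  shows "expect P x = expect P y"
proof -
  have "expect P x = braket x (P *v y)" by (simp add: expect_def assms(2))
  also have "\<dots> = cnj (braket y (P *v y))" by (subst hermitian_braket[OF assms(1)]) (simp add: assms(2))
  also have "\<dots> = expect P y"
    using hermitian_braket[OF assms(1), of y y] by (simp add: expect_def)
  finally show ?thesis .
qed

text \<open>Real and imaginary \<open>\<tau>\<close> separate the two coefficients.\<close>

lemma psd_kernel_of_quartic_curve:
  assumes P: "psd P"
    and bound: "\<And>\<tau>. Re (expect P (z \<tau>)) \<le> C * cmod \<tau> ^ 4"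
    and image: "\<And>\<tau>. P *v z \<tau> = P *v (cnj \<tau> *s u + \<tau> *s v)"
  shows "P *v u = 0" and "P *v v = 0"
proof -
  have h: "hermitian P" using P by (simp add: psd_def)
  \<comment> \<open>On the ray \<tau> = \<open>t d\<close> the curve is, modulo the kernel,
    \<open>t y\<close> times the phase \<open>c\<close>. The left side of the bound is therefore
    \<open>t^2\<close> times \<open>expect P y\<close> while the right side is of order
    \<open>t^4\<close>, so dividing by \<open>t^2\<close> and letting \<open>t\<close> tend to 0
    forces \<open>expect P y\<close> to vanish. The directions 1 and \<open>\<i>\<close> yield
    \<open>y = u + v\<close> and \<open>y = v - u\<close>.\<close>
  have null: "P *v y = 0"
    if y: "\<And>t. \<exists>c. cmod c = 1 \<and> P *v z (of_real t * d) = P *v ((of_real t * c) *s y)"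
      and d: "cmod d = 1" for y d
  proof -
    have le: "Re (expect P y) \<le> C * t\<^sup>2" if t: "t > 0" for t :: real
    proof -
      obtain c where c: "cmod c = 1" "P *v z (of_real t * d) = P *v ((of_real t * c) *s y)"
        using y by blast
      have "t\<^sup>2 * Re (expect P y) = Re (expect P (z (of_real t * d)))"
        using expect_cong_image[OF h c(2)] c(1) t
        by (simp add: expect_scale norm_mult del: of_real_power)
      also have "\<dots> \<le> C * t ^ 4" using bound[of "of_real t * d"] d t by (simp add: norm_mult)
      also have "\<dots> = t\<^sup>2 * (C * t\<^sup>2)" by (simp add: power4_eq_xxxx power2_eq_square)
      finally show ?thesis using t by simp
    qed
    have "((\<lambda>t. C * t\<^sup>2) \<longlongrightarrow> C * 0\<^sup>2) (at_right 0)"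
      by (intro tendsto_intros)
    then have "Re (expect P y) \<le> C * 0\<^sup>2"
      by (rule tendsto_lowerbound)
        (auto simp: eventually_at_right_field intro: le exI[of _ 1])
    moreover have "0 \<le> Re (expect P y)" using P by (simp add: psd_iff_expect)
    ultimately have "expect P y = 0"
      using hermitian_expect_real[OF h, of y] by (simp add: complex_eq_iff)
    then show ?thesis by (rule psd_kernel[OF P])
  qed
  have "P *v (u + v) = 0"
    by (rule null[of 1]) (auto intro!: exI[of _ 1] simp: image vector_add_ldistrib)
  moreover have "P *v (v - u) = 0"
  proof (rule null[of \<i>])
    fix t :: real
    have "cnj (of_real t * \<i>) *s u + (of_real t * \<i>) *s v = (of_real t * \<i>) *s (v - u)"
      by (simp add: vec_eq_iff algebra_simps)
    then show "\<exists>c. cmod c = 1 \<and> P *v z (of_real t * \<i>) = P *v ((of_real t * c) *s (v - u))"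
      by (intro exI[of _ \<i>]) (simp add: image)
  qed simp
  ultimately have s: "P *v u + P *v v = 0" and d: "P *v v - P *v u = 0"
    by (simp_all add: matrix_vector_right_distrib matrix_vector_mult_diff_distrib)
  from s d show "P *v u = 0" by (simp add: vec_eq_iff)
  with s show "P *v v = 0" by simp
qed

section \<open>Finer witnesses and a criterion for optimality\<close>

lemma finer_expect_pair:
  fixes W W' :: "('m::finite, 'n::finite) bipartite_op"
  assumes "finer W' W" and hW: "hermitian W" and hW': "hermitian W'"
    and neg: "Re (expect W x) + Re (expect W y) < 0"
  shows "Re (expect W' x) + Re (expect W' y) < 0"
proof -
  define T where "T = Re (braket x x) + Re (braket y y)"
  \<comment> \<open>The mixture of two pure states, normalised by its trace \<open>T\<close>. Pure
    states alone would constrain \<open>W'\<close> only where \<open>W\<close> has negative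
    expectation; mixing with a second vector also reaches the nonnegative directions.\<close>
  define \<rho> where "\<rho> = (1 / T) *\<^sub>R (rank_one x + rank_one y)"
  have "\<not> (x = 0 \<and> y = 0)" using neg by (auto simp: expect_def braket_def)
  then have T: "T > 0"
    using braket_self_eq_0[of x] braket_self_eq_0[of y] Re_braket_self_nonneg[of x]
      Re_braket_self_nonneg[of y] by (force simp: T_def)
  have "trace (rank_one x + rank_one y) = of_real T"
    by (simp add: trace_add trace_rank_one T_def complex_eq_iff braket_self del: of_real_power)
  then have "state \<rho>"
    using T by (auto simp: state_def \<rho>_def trace_scaleR intro!: psd_scaleR psd_add psd_rank_one)
  moreover have tr: "trace (\<rho> ** A) = of_real (1 / T) * (expect A x + expect A y)" for A
    by (simp add: \<rho>_def scaleR_matrix_mult trace_scaleR matrix_add_rdistrib trace_add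
        trace_mult_rank_one)
  have "trace (\<rho> ** W) < 0"
    using neg T hermitian_expect_real[OF hW]
    by (simp add: tr less_complex_def divide_less_0_iff)
  ultimately have "trace (\<rho> ** W') < 0"
    using assms(1) by (auto simp: finer_def detected_def)
  then show ?thesis
    using T by (simp add: tr less_complex_def divide_less_0_iff)
qed

text \<open>The factor \<mu> is the infimum of the ratios \<open>w' x / w x\<close> over points with
  \<open>w x < 0\<close>, so negative points satisfy the bound by definition. A point with
  \<open>w y \<ge> 0\<close> is mixed with a negative point until the sum is barely negative, which
  gives \<open>w' y \<le> r * w y\<close> for every ratio \<open>r\<close>, hence for the infimum
  when \<open>w y > 0\<close>.\<close>

lemma dominated_of_negative_pairs:
  fixes w w' :: "'a \<Rightarrow> real"
  assumes pair: "\<And>x y s. 0 \<le> s \<Longrightarrow> s * w x + w y < 0 \<Longrightarrow> s * w' x + w' y < 0"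
    and ex: "w x0 < 0"
  obtains \<mu> where "0 \<le> \<mu>" and "\<And>y. w' y \<le> \<mu> * w y"
proof -
  define R where "R = {w' x / w x | x. w x < 0}"
  define \<mu> where "\<mu> = Inf R"
  have neg: "w' x < 0" if "w x < 0" for x using pair[of 0 x x] that by simp
  have nonneg: "0 \<le> r" if "r \<in> R" for r
    using that neg by (force simp: R_def intro: divide_nonpos_neg less_imp_le)
  have ne: "R \<noteq> {}" using ex by (auto simp: R_def)
  have bdd: "bdd_below R" using nonneg by (auto intro: bdd_belowI[of _ 0])
  have cross: "w' y \<le> r * w y" if r: "r \<in> R" and y: "0 \<le> w y" for r y
  proof -
    obtain x where x: "w x < 0" "r = w' x / w x" using r by (auto simp: R_def)
    have "w' y \<le> r * w y + e" if e: "e > 0" for e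
    proof -
      \<comment> \<open>The first summand is the weight that balances \<open>s * w x + w y\<close>
        to zero. The second makes the sum strictly negative and contributes exactly
        \<open>- e\<close> to \<open>s * w' x\<close>.\<close>
      define s where "s = w y / (- w x) + e / (- w' x)"
      have "0 < e / (- w' x)" using e neg[OF x(1)] by (intro divide_pos_pos) auto
      moreover have "0 \<le> w y / (- w x)" using y x(1) by (intro divide_nonneg_pos) auto
      ultimately have "0 \<le> s" "w y / (- w x) < s" by (auto simp: s_def)
      moreover have "s * w x + w y < 0"
        using \<open>w y / (- w x) < s\<close> x(1) by (simp add: field_simps)
      ultimately have "s * w' x + w' y < 0" using pair by blast
      moreover have "s * w' x = - (r * w y) - e"
        using x neg[OF x(1)] by (simp add: s_def field_simps)
      ultimately show ?thesis by simp
    qed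
    then show ?thesis by (rule field_le_epsilon)
  qed
  show ?thesis
  proof
    show "0 \<le> \<mu>" unfolding \<mu>_def using ne nonneg by (intro cInf_greatest)
    fix y
    consider "w y < 0" | "w y = 0" | "w y > 0" by linarith
    then show "w' y \<le> \<mu> * w y"
    proof cases
      case 1
      then have "\<mu> \<le> w' y / w y" unfolding \<mu>_def
        by (intro cInf_lower bdd) (auto simp: R_def)
      then show ?thesis using 1 by (simp add: neg_le_divide_eq)
    next
      case 2
      then show ?thesis using ne cross[of _ y] by auto
    next
      case 3
      then have "w' y / w y \<le> \<mu>" unfolding \<mu>_def
        using ne cross[of _ y] by (intro cInf_greatest) (auto simp: divide_le_eq)
      then show ?thesis using 3 by (simp add: divide_le_eq)
    qed
  qed
qed

text \<open>The ratio argument of Lewenstein, Kraus, Cirac and Horodecki.\<close>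

lemma finer_imp_psd_difference:
  fixes W W' :: "('m::finite, 'n::finite) bipartite_op"
  assumes "finer W' W" and hW: "hermitian W" and hW': "hermitian W'"
    and "Re (expect W x) < 0"
  obtains \<mu> where "0 \<le> \<mu>" and "psd (\<mu> *\<^sub>R W - W')"
proof -
  \<comment> \<open>The weight is absorbed into the vector: scaling \<open>x\<close> by the square
    root of \<open>s\<close> multiplies its expectation by \<open>s\<close>.\<close>
  have "s * Re (expect W' x) + Re (expect W' y) < 0"
    if "0 \<le> s" "s * Re (expect W x) + Re (expect W y) < 0" for s x y
    using finer_expect_pair[OF assms(1-3), of "complex_of_real (sqrt s) *s x" y] that
    by (simp add: expect_scale del: of_real_power)
  then obtain \<mu> where \<mu>: "0 \<le> \<mu>" "\<And>y. Re (expect W' y) \<le> \<mu> * Re (expect W y)"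
    using dominated_of_negative_pairs[of "\<lambda>x. Re (expect W x)" "\<lambda>x. Re (expect W' x)"] assms(4)
    by metis
  have "psd (\<mu> *\<^sub>R W - W')"
    using \<mu>(2) by (simp add: psd_iff_expect hermitian_diff hermitian_scaleR hW hW' expect_diff
        expect_scaleR)
  with \<mu>(1) show ?thesis by (rule that)
qed

text \<open>For a finer \<open>W'\<close>, the matrix \<open>P = \<mu> W - W'\<close> is positive
  for some \<mu>, and block-positivity of \<open>W'\<close> bounds \<open>P\<close> by
  \<open>\<mu> W\<close> on product vectors. Rigidity then makes \<open>W'\<close> a multiple of
  \<open>W\<close>, which detects the same states.\<close>

lemma optimal_witnessI:
  fixes W :: "('m::finite, 'n::finite) bipartite_op"
  assumes W: "entanglement_witness W" and "Re (expect W x) < 0"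
    and rigid: "\<And>\<mu> P. \<lbrakk>0 \<le> \<mu>; psd P;
        \<And>e f. Re (expect P (tensor_vec e f)) \<le> \<mu> * Re (expect W (tensor_vec e f))\<rbrakk> \<Longrightarrow> P = 0"
  shows "optimal_witness W"
  unfolding optimal_witness_def
proof (intro conjI W notI)
  assume "\<exists>W'. entanglement_witness W' \<and> finer W' W \<and> detected W' \<noteq> detected W"
  then obtain W' where W': "entanglement_witness W'" "finer W' W" "detected W' \<noteq> detected W"
    by blast
  have hW: "hermitian W" and hW': "hermitian W'"
    using W W'(1) by (auto simp: entanglement_witness_def)
  obtain \<mu> where \<mu>: "0 \<le> \<mu>" "psd (\<mu> *\<^sub>R W - W')"
    using finer_imp_psd_difference[OF W'(2) hW hW' assms(2)] .
  have "0 \<le> Re (expect W' (tensor_vec e f))" for e f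
    using W'(1) by (simp add: entanglement_witness_def block_positive_def expect_def
        less_eq_complex_def)
  then have "\<mu> *\<^sub>R W - W' = 0"
    by (intro rigid[OF \<mu>]) (simp add: expect_diff expect_scaleR)
  then have eq: "W' = \<mu> *\<^sub>R W" by simp
  \<comment> \<open>A witness has negative trace against some state, so \<open>W'\<close> is not
    zero.\<close>
  have "\<mu> \<noteq> 0"
    using W'(1) eq by (auto simp: entanglement_witness_def trace_def matrix_matrix_mult_def)
  then have "\<mu> > 0" using \<mu>(1) by simp
  then have "detected W' = detected W"
    by (simp add: detected_def eq matrix_mult_scaleR trace_scaleR less_complex_def
        mult_less_0_iff)
  with W'(3) show False by simp
qed

section \<open>Partial transposition and product vectors\<close>

definition cnj_vec :: "complex^'i \<Rightarrow> complex^'i" where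
  "cnj_vec x = (\<chi> i. cnj (x $ i))"

lemma sum_prod_UNIV: "sum g UNIV = (\<Sum>i\<in>UNIV. \<Sum>j\<in>UNIV. g (i, j))"
  by (simp add: sum.cartesian_product)

text \<open>Transposing the second factor amounts to conjugating its vector, because
  \<open>f\<close> enters the expectation once conjugated and once not, and the transposition
  exchanges these two roles.\<close>

lemma expect_partial_transpose:
  "expect (partial_transpose X) (tensor_vec e f) = expect X (tensor_vec e (cnj_vec f))"
proof -
  have expand: "expect A x = (\<Sum>i\<in>UNIV. \<Sum>j\<in>UNIV. \<Sum>k\<in>UNIV. \<Sum>l\<in>UNIV.
      cnj (x $ (i, j)) * (A $ (i, j) $ (k, l) * x $ (k, l)))"
    for A :: "('m::finite, 'n::finite) bipartite_op" and x
    by (simp add: expect_def braket_def matrix_vector_mult_def sum_prod_UNIV sum_distrib_left)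
  have "expect (partial_transpose X) (tensor_vec e f) =
      (\<Sum>i\<in>UNIV. \<Sum>j\<in>UNIV. \<Sum>k\<in>UNIV. \<Sum>l\<in>UNIV.
      cnj (e $ i) * cnj (f $ j) * (X $ (i, l) $ (k, j) * (e $ k * f $ l)))"
    by (simp add: expand partial_transpose_def tensor_vec_def)
  \<comment> \<open>Three swaps of adjacent sums turn the order \<open>i j k l\<close> into
    \<open>i l k j\<close>, which matches the expansion of \<open>X\<close> with \<open>j\<close>
    and \<open>l\<close> exchanged.\<close>
  also have "\<dots> = (\<Sum>i\<in>UNIV. \<Sum>k\<in>UNIV. \<Sum>j\<in>UNIV. \<Sum>l\<in>UNIV.
      cnj (e $ i) * cnj (f $ j) * (X $ (i, l) $ (k, j) * (e $ k * f $ l)))"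
    by (intro sum.cong refl sum.swap)
  also have "\<dots> = (\<Sum>i\<in>UNIV. \<Sum>k\<in>UNIV. \<Sum>l\<in>UNIV. \<Sum>j\<in>UNIV.
      cnj (e $ i) * cnj (f $ j) * (X $ (i, l) $ (k, j) * (e $ k * f $ l)))"
    by (intro sum.cong refl sum.swap)
  also have "\<dots> = (\<Sum>i\<in>UNIV. \<Sum>l\<in>UNIV. \<Sum>k\<in>UNIV. \<Sum>j\<in>UNIV.
      cnj (e $ i) * cnj (f $ j) * (X $ (i, l) $ (k, j) * (e $ k * f $ l)))"
    by (intro sum.cong refl sum.swap)
  also have "\<dots> = expect X (tensor_vec e (cnj_vec f))"
    by (simp add: expand cnj_vec_def tensor_vec_def mult_ac)
  finally show ?thesis .
qed

lemma tensor_vec_add_left: "tensor_vec (x + y) f = tensor_vec x f + tensor_vec y f"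
  by (simp add: tensor_vec_def vec_eq_iff algebra_simps)

lemma tensor_vec_add_right: "tensor_vec e (x + y) = tensor_vec e x + tensor_vec e y"
  by (simp add: tensor_vec_def vec_eq_iff algebra_simps)

lemma tensor_vec_scale_left: "tensor_vec (c *s x) f = c *s tensor_vec x f"
  by (simp add: tensor_vec_def vec_eq_iff)

lemma tensor_vec_scale_right: "tensor_vec e (c *s x) = c *s tensor_vec e x"
  by (simp add: tensor_vec_def vec_eq_iff)

lemma tensor_vec_axis: "tensor_vec (axis i 1) (axis j 1) = axis (i, j) 1"
  by (auto simp: tensor_vec_def vec_eq_iff axis_def)

lemma obtain_three_distinct:
  assumes "CARD('a::finite) \<ge> 3"
  obtains a b c :: "'a::finite" where "a \<noteq> b" "b \<noteq> c" "a \<noteq> c"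
proof -
  obtain S :: "'a::finite set" where "card S = 3"
    using obtain_subset_with_card_n[OF assms] by blast
  then show ?thesis using that by (auto simp: card_3_iff)
qed

section \<open>The witness, built on three coordinates of each factor\<close>

locale index_triples =
  fixes i1 i2 i3 :: "'m::finite" and j1 j2 j3 :: "'n::finite"
  assumes i: "i1 \<noteq> i2" "i2 \<noteq> i3" "i1 \<noteq> i3"
    and j: "j1 \<noteq> j2" "j2 \<noteq> j3" "j1 \<noteq> j3"
begin

abbreviation ket :: "'m \<Rightarrow> 'n \<Rightarrow> complex^('m \<times> 'n)" where
  "ket p q \<equiv> axis (p, q) 1"

text \<open>Without \<open>ket i3 j1\<close> in the first vector the three forms would be the 2x2
  minors of (x, y, z) and (a, b, c). Their zeros include all pairs with (a, b, c) equal to (x, y,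
  z), whose product vectors span the 3x3 block. The extra term removes every zero with xc
  nonzero.\<close>

definition Q :: "('m, 'n) bipartite_op" where
  "Q = rank_one (ket i1 j2 - ket i2 j1 + ket i3 j1) + rank_one (ket i1 j3 - ket i3 j1)
     + rank_one (ket i2 j3 - ket i3 j2)"

definition W :: "('m, 'n) bipartite_op" where
  "W = partial_transpose Q"

lemma neq: "i2 \<noteq> i1" "i3 \<noteq> i2" "i3 \<noteq> i1" "j2 \<noteq> j1" "j3 \<noteq> j2" "j3 \<noteq> j1"
  using i j by auto

lemma psd_Q: "psd Q"
  unfolding Q_def by (intro psd_add psd_rank_one)

lemma hermitian_W: "hermitian W"
  using psd_Q by (simp add: W_def psd_def hermitian_partial_transpose)

lemma expect_W_tensor_vec:
  "expect W (tensor_vec e f) = of_real (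
      (cmod (e $ i1 * cnj (f $ j2) - e $ i2 * cnj (f $ j1) + e $ i3 * cnj (f $ j1)))\<^sup>2
    + (cmod (e $ i1 * cnj (f $ j3) - e $ i3 * cnj (f $ j1)))\<^sup>2
    + (cmod (e $ i2 * cnj (f $ j3) - e $ i3 * cnj (f $ j2)))\<^sup>2)"
  unfolding W_def expect_partial_transpose Q_def expect_add expect_rank_one
  by (simp add: braket_add_left braket_diff_left braket_axis tensor_vec_def cnj_vec_def
      del: of_real_power)

lemma block_positive_W: "block_positive W"
  using expect_W_tensor_vec
  by (simp add: block_positive_def expect_def[symmetric] less_eq_complex_def del: of_real_power)

text \<open>Partial transposition moves the entry -1 of \<open>Q\<close> between
  \<open>ket i1 j2\<close> and \<open>ket i2 j1\<close> to the position between
  \<open>ket i1 j1\<close> and \<open>ket i2 j2\<close>, where the diagonal entries are 0.\<close>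

lemma expect_W_negative: "expect W (ket i1 j1 + ket i2 j2) = - 2"
proof -
  have "expect W (ket i1 j1 + ket i2 j2) =
      W $ (i1, j1) $ (i1, j1) + W $ (i1, j1) $ (i2, j2) + W $ (i2, j2) $ (i1, j1)
      + W $ (i2, j2) $ (i2, j2)"
    by (simp add: expect_def braket_add_left braket_axis matrix_vector_right_distrib
        matrix_vector_mult_axis)
  also have "\<dots> = - 2"
    using i j neq by (simp add: W_def partial_transpose_def Q_def rank_one_def axis_def)
  finally show ?thesis .
qed

lemma entanglement_witness_W: "entanglement_witness W"
  unfolding entanglement_witness_def
proof (intro conjI hermitian_W block_positive_W exI)
  let ?\<psi> = "ket i1 j1 + ket i2 j2"
  let ?\<rho> = "(1 / 2) *\<^sub>R rank_one ?\<psi>"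
  have "braket ?\<psi> ?\<psi> = 2"
    using i j neq by (simp add: braket_add_left braket_axis) (simp add: axis_def)
  then show "state ?\<rho>"
    by (simp add: state_def psd_scaleR psd_rank_one trace_scaleR trace_rank_one)
  have "trace (W ** ?\<rho>) = trace (?\<rho> ** W)" by (rule trace_mul_sym)
  also have "\<dots> = - 1"
    by (simp add: scaleR_matrix_mult trace_scaleR trace_mult_rank_one expect_W_negative)
  finally show "trace (W ** ?\<rho>) < 0" by (simp add: less_complex_def)
qed

lemma decomposable_witness_W: "decomposable_witness W"
  unfolding decomposable_witness_def
  using entanglement_witness_W psd_zero psd_Q W_def by force

text \<open>\<open>P\<close> is shown to kill every basis vector in stages: first those with zero
  expectation in \<open>W\<close>, then the remaining six in pairs along three curves. The third
  curve comes last, since reducing it to its linear part uses the kernel vectors found with the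
  first two.\<close>

lemma rigid_W:
  assumes P: "psd P"
    and bound: "\<And>e f. Re (expect P (tensor_vec e f)) \<le> \<mu> * Re (expect W (tensor_vec e f))"
  shows "P = 0"
proof -
  have h: "hermitian P" using P by (simp add: psd_def)
  have zero: "P *v ket p q = 0" if "expect W (ket p q) = 0" for p q
  proof (rule psd_kernel[OF P])
    have "Re (expect P (ket p q)) \<le> 0"
      using bound[of "axis p 1" "axis q 1"] that by (simp add: tensor_vec_axis)
    moreover have "0 \<le> Re (expect P (ket p q))" using P by (simp add: psd_iff_expect)
    ultimately show "expect P (ket p q) = 0"
      using hermitian_expect_real[OF h, of "ket p q"] by (simp add: complex_eq_iff)
  qed
  \<comment> \<open>The six excluded pairs are the basis vectors occurring in \<open>Q\<close>; at
    any other basis vector all three forms vanish.\<close>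
  have expect_ket: "expect W (ket p q) = 0"
    if "(p, q) \<notin> {(i1, j2), (i2, j1), (i1, j3), (i3, j1), (i2, j3), (i3, j2)}" for p q
    unfolding tensor_vec_axis[symmetric] expect_W_tensor_vec
    using that by (auto simp: axis_def)
  have diag: "P *v ket i1 j1 = 0" "P *v ket i2 j2 = 0" "P *v ket i3 j3 = 0"
    using i j neq by (auto intro!: zero expect_ket)
  note expand = tensor_vec_add_left tensor_vec_add_right tensor_vec_scale_left
    tensor_vec_scale_right tensor_vec_axis matrix_vector_right_distrib vector_scalar_commute

  \<comment> \<open>Here (x, y, z) and (a, b, c) both equal (1, \<tau>, 0), so the whole curve
    consists of zeros of \<open>W\<close> and the quartic bound holds with constant 0. The next
    curve does the same with (0, 1, \<tau>).\<close>
  let ?z = "\<lambda>\<tau>. tensor_vec (axis i1 1 + \<tau> *s axis i2 1) (axis j1 1 + cnj \<tau> *s axis j2 1)"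
  have "Re (expect P (?z \<tau>)) \<le> 0 * cmod \<tau> ^ 4" for \<tau>
    by (rule order_trans[OF bound], subst expect_W_tensor_vec)
      (use i j neq in \<open>simp add: axis_def\<close>)
  moreover have "P *v ?z \<tau> = P *v (cnj \<tau> *s ket i1 j2 + \<tau> *s ket i2 j1)" for \<tau>
    by (simp add: expand diag)
  ultimately have k12: "P *v ket i1 j2 = 0" "P *v ket i2 j1 = 0"
    by (rule psd_kernel_of_quartic_curve[OF P])+

  let ?z = "\<lambda>\<tau>. tensor_vec (axis i2 1 + \<tau> *s axis i3 1) (axis j2 1 + cnj \<tau> *s axis j3 1)"
  have "Re (expect P (?z \<tau>)) \<le> 0 * cmod \<tau> ^ 4" for \<tau>
    by (rule order_trans[OF bound], subst expect_W_tensor_vec)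
      (use i j neq in \<open>simp add: axis_def\<close>)
  moreover have "P *v ?z \<tau> = P *v (cnj \<tau> *s ket i2 j3 + \<tau> *s ket i3 j2)" for \<tau>
    by (simp add: expand diag)
  ultimately have k23: "P *v ket i2 j3 = 0" "P *v ket i3 j2 = 0"
    by (rule psd_kernel_of_quartic_curve[OF P])+

  \<comment> \<open>Here only the first-order jet, not the curve, lies in the zero set of \<^const>\<open>W\<close>.\<close>
  let ?z = "\<lambda>\<tau>. tensor_vec (axis i1 1 + \<tau> *s axis i2 1 + \<tau> *s axis i3 1)
    (axis j1 1 + cnj \<tau> *s axis j3 1)"
  have "Re (expect P (?z \<tau>)) \<le> \<mu> * cmod \<tau> ^ 4" for \<tau>
    by (rule order_trans[OF bound], subst expect_W_tensor_vec)
      (use i j neq in \<open>simp add: axis_def norm_mult power_mult_distrib flip: power_add\<close>)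
  moreover have "P *v ?z \<tau> = P *v (cnj \<tau> *s ket i1 j3 + \<tau> *s ket i3 j1)" for \<tau>
    by (simp add: expand diag k12 k23)
  ultimately have k13: "P *v ket i1 j3 = 0" "P *v ket i3 j1 = 0"
    by (rule psd_kernel_of_quartic_curve[OF P])+

  have "P *v ket p q = 0" for p q
    using zero[OF expect_ket, of p q] k12 k23 k13 by auto
  then have "P $ r $ (p, q) = 0" for r p q
    by (metis matrix_vector_mult_axis zero_index)
  then show "P = 0" by (auto simp: vec_eq_iff)
qed

lemma optimal_witness_W: "optimal_witness W"
proof (rule optimal_witnessI[OF entanglement_witness_W])
  show "Re (expect W (ket i1 j1 + ket i2 j2)) < 0" by (simp add: expect_W_negative)
qed (rule rigid_W)

text \<open>The vanishing of xc at every zero puts all zeros into the hyperplane where the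
  coordinate \<open>(i1, j3)\<close> is 0.\<close>

lemma zero_product_vectors_W_not_spanning: "vec.span (zero_product_vectors W) \<noteq> UNIV"
proof -
  let ?S = "{v :: complex^('m \<times> 'n). v $ (i1, j3) = 0}"
  have sub: "zero_product_vectors W \<subseteq> ?S"
  proof
    fix v assume "v \<in> zero_product_vectors W"
    then obtain e f where v: "v = tensor_vec e f" and zero: "expect W (tensor_vec e f) = 0"
      by (auto simp: zero_product_vectors_def expect_def)
    have sum3: "a = 0 \<and> b = 0 \<and> c = 0"
      if "(cmod a)\<^sup>2 + (cmod b)\<^sup>2 + (cmod c)\<^sup>2 = 0" for a b c
      using that by (simp add: add_nonneg_eq_0_iff)
    have eqs: "e $ i1 * cnj (f $ j2) - e $ i2 * cnj (f $ j1) + e $ i3 * cnj (f $ j1) = 0"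
      "e $ i1 * cnj (f $ j3) - e $ i3 * cnj (f $ j1) = 0"
      "e $ i2 * cnj (f $ j3) - e $ i3 * cnj (f $ j2) = 0"
      using sum3 zero unfolding expect_W_tensor_vec of_real_eq_0_iff by blast+
    \<comment> \<open>With F1, F2, F3 the three forms in the order of \<open>eqs\<close>, the
      identity is xc^2 = c F1 + (c - b) F2 + a F3.\<close>
    have "e $ i1 * (cnj (f $ j3))\<^sup>2 = 0"
      using eqs by algebra
    then show "v \<in> ?S" by (auto simp: v tensor_vec_def)
  qed
  have "vec.subspace ?S"
    by (auto simp: vec.subspace_def)
  with sub have "vec.span (zero_product_vectors W) \<subseteq> ?S" by (rule vec.span_minimal)
  moreover have "ket i1 j3 \<notin> ?S" by (simp add: axis_def)
  ultimately show ?thesis by blast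
qed

end

theorem mainTheorem1:
  assumes "CARD('m::finite) \<ge> 3" and "CARD('n::finite) \<ge> 3"
  shows "\<exists>W :: ('m, 'n) bipartite_op.
           optimal_witness W \<and> decomposable_witness W \<and>
           vec.span (zero_product_vectors W) \<noteq> UNIV"
proof -
  obtain i1 i2 i3 :: 'm where i: "i1 \<noteq> i2" "i2 \<noteq> i3" "i1 \<noteq> i3"
    using obtain_three_distinct[OF assms(1)] .
  obtain j1 j2 j3 :: 'n where j: "j1 \<noteq> j2" "j2 \<noteq> j3" "j1 \<noteq> j3"
    using obtain_three_distinct[OF assms(2)] .
  interpret index_triples i1 i2 i3 j1 j2 j3
    using i j by unfold_locales
  show ?thesis
    using optimal_witness_W decomposable_witness_W zero_product_vectors_W_not_spanning by blast
qed

end
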